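(* If $A$ is a coherent $PF$-quantale, then $\mathrm{Spec}(\mathrm{Vir}(A))=\mathrm{Max}(\mathrm{Vir}(A))$.
   Context: A quantale is a complete lattice $(A,\vee,\wedge,0,1)$ with an associative multiplication distributing over arbitrary joins in each variable. All quantales are assumed commutative and integral ($1$ is the multiplicative unit). $K(A)$ is the set of compact elements. $A$ is algebraic if every element is a join of compact elements; $A$ is coherent if it is algebraic, $1\in K(A)$ and $K(A)$ is closed under multiplication. $a^{\perp}=\bigvee\{x\in A: ax=0\}$. An element $a$ is pure if for all $c\in K(A)$, $c\le a$ implies $a\vee c^{\perp}=1$; the set $\mathrm{Vir}(A)$ of pure elements is a frame with the joins and finite meets of $A$. $\mathrm{Spec}(\mathrm{Vir}(A))$ is the set of prime elements of this frame ($p\in \mathrm{Vir}(A)$, $p<1$, and $a\wedge b\le p$ implies $a\le p$ or $b\le p$ for all $a,b\in \mathrm{Vir}(A)$), and $\mathrm{Max}(\mathrm{Vir}(A))$ is the set of maximal elements of $\mathrm{Vir}(A)\setminus\{1\}$. $A$ is a $PF$-quantale if $c^{\perp}$ is pure for every $c\in K(A)$. *)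

theory Defs
  imports Main
begin

class quantale = complete_lattice + semigroup_mult +
  assumes mult_Sup_right: "a * Sup X = Sup ((\<lambda>x. a * x) ` X)"
    and mult_Sup_left: "Sup X * a = Sup ((\<lambda>x. x * a) ` X)"

text \<open>The least element 0 of a quantale is written \<open>bot\<close>. By integrality the greatest
  element and the multiplicative unit coincide, and both are written \<open>1\<close>.\<close>

class comm_integral_quantale = quantale + comm_monoid_mult +
  assumes one_eq_top: "1 = top"

definition (in complete_lattice) compact_elements :: "'a set"
  where "compact_elements = {c. \<forall>X. c \<le> Sup X \<longrightarrow> (\<exists>Y\<subseteq>X. finite Y \<and> c \<le> Sup Y)}"

definition (in comm_integral_quantale) annihilator :: "'a \<Rightarrow> 'a"  (\<open>_\<^sup>\<bottom>\<close> [1000] 1000)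
  where "a\<^sup>\<bottom> = Sup {x. a * x = bot}"

definition (in comm_integral_quantale) pure :: "'a \<Rightarrow> bool"
  where "pure a \<longleftrightarrow> (\<forall>c\<in>compact_elements. c \<le> a \<longrightarrow> sup a c\<^sup>\<bottom> = 1)"

definition (in comm_integral_quantale) Vir :: "'a set"
  where "Vir = {a. pure a}"

class algebraic_quantale = comm_integral_quantale +
  assumes algebraic: "\<exists>X\<subseteq>compact_elements. a = Sup X"

class coherent_quantale = algebraic_quantale +
  assumes one_compact: "1 \<in> compact_elements"
    and mult_compact: "c \<in> compact_elements \<Longrightarrow> d \<in> compact_elements \<Longrightarrow> c * d \<in> compact_elements"

class pf_quantale = comm_integral_quantale +
  assumes pure_annihilator: "c \<in> compact_elements \<Longrightarrow> pure c\<^sup>\<bottom>"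

text \<open>In the next two definitions \<open>L\<close> is a set of elements of the quantale containing \<open>1\<close>
  and closed under the binary meets of the quantale, so that \<open>inf\<close> is the meet of \<open>L\<close>;
  \<open>Vir\<close> is such a set by the closure lemmas below.\<close>

definition (in comm_integral_quantale) Spec :: "'a set \<Rightarrow> 'a set"
  where "Spec L = {p\<in>L. p < 1 \<and> (\<forall>a\<in>L. \<forall>b\<in>L. inf a b \<le> p \<longrightarrow> a \<le> p \<or> b \<le> p)}"

definition (in comm_integral_quantale) Max_elements :: "'a set \<Rightarrow> 'a set"
  where "Max_elements L = {m \<in> L - {1}. \<forall>x \<in> L - {1}. m \<le> x \<longrightarrow> x = m}"

lemma mult_sup_right: "a * sup b c = sup (a * b) (a * c)" for a :: "'a::quantale"
  using mult_Sup_right[of a "{b, c}"] by simp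

lemma mult_mono_right: "b \<le> c \<Longrightarrow> a * b \<le> a * c" for a :: "'a::quantale"
  by (metis mult_sup_right sup.absorb_iff2 sup.orderI)

lemma le_one: "a \<le> 1" for a :: "'a::comm_integral_quantale"
  by (simp add: one_eq_top)

lemma mult_le_inf: "a * b \<le> inf a b" for a :: "'a::comm_integral_quantale"
  by (metis inf.boundedI le_one mult.commute mult.right_neutral mult_mono_right)

lemma mult_annihilator: "a * a\<^sup>\<bottom> = bot" for a :: "'a::comm_integral_quantale"
  unfolding annihilator_def mult_Sup_right by (auto intro: antisym SUP_least)

lemma le_annihilator_iff: "x \<le> a\<^sup>\<bottom> \<longleftrightarrow> a * x = bot" for a :: "'a::comm_integral_quantale"
proof
  assume "x \<le> a\<^sup>\<bottom>"
  then show "a * x = bot"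
    by (metis mult_mono_right mult_annihilator bot.extremum_unique)
next
  assume "a * x = bot"
  then show "x \<le> a\<^sup>\<bottom>"
    unfolding annihilator_def by (auto intro: Sup_upper)
qed

lemma sup_inf_eq_one:
  fixes a b c :: "'a::comm_integral_quantale"
  assumes "sup a c = 1" "sup b c = 1"
  shows "sup (inf a b) c = 1"
proof -
  have "1 = sup a c * sup b c"
    using assms by simp
  also have "\<dots> = sup (sup a c * b) (sup a c * c)"
    by (rule mult_sup_right)
  also have "sup a c * b = sup (b * a) (b * c)"
    by (metis mult.commute mult_sup_right)
  also have "sup (sup (b * a) (b * c)) (sup a c * c) \<le> sup (inf a b) c"
  proof (intro sup.boundedI)
    show "b * a \<le> sup (inf a b) c"
      by (metis mult_le_inf inf.commute le_supI1)
    show "b * c \<le> sup (inf a b) c" "sup a c * c \<le> sup (inf a b) c"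
      by (meson mult_le_inf inf.boundedE le_supI2)+
  qed
  finally show ?thesis
    by (simp add: le_one antisym)
qed

lemma one_in_Vir: "1 \<in> Vir"
  by (simp add: Vir_def pure_def one_eq_top)

lemma inf_in_Vir: "a \<in> Vir \<Longrightarrow> b \<in> Vir \<Longrightarrow> inf a b \<in> Vir"
  by (simp add: Vir_def pure_def sup_inf_eq_one)

lemma Sup_in_Vir:
  fixes X :: "'a::algebraic_quantale set"
  assumes "X \<subseteq> Vir"
  shows "Sup X \<in> Vir"
  unfolding Vir_def pure_def
proof (intro CollectI ballI impI)
  fix c :: 'a assume c: "c \<in> compact_elements" "c \<le> Sup X"
  define D where "D = {d \<in> compact_elements. \<exists>a\<in>X. d \<le> a}"
  have "a \<le> Sup D" if "a \<in> X" for a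
  proof -
    obtain Z where Z: "Z \<subseteq> compact_elements" "a = Sup Z"
      using algebraic by blast
    then have "Z \<subseteq> D"
      using that by (auto simp: D_def intro: Sup_upper)
    then show ?thesis
      using Z by (simp add: Sup_subset_mono)
  qed
  then have "c \<le> Sup D"
    using c(2) by (meson Sup_least order_trans)
  then obtain Y where Y: "Y \<subseteq> D" "finite Y" "c \<le> Sup Y"
    using c(1) unfolding compact_elements_def by blast
  have "sup (Sup X) (Sup Y)\<^sup>\<bottom> = 1"
    using Y(2,1)
  proof (induction Y rule: finite_induct)
    case empty
    have "(1::'a) \<le> bot\<^sup>\<bottom>"
      using mult_le_inf[of bot "1::'a"] by (simp add: le_annihilator_iff)
    then show ?case
      by (simp add: antisym le_one le_supI2)
  next
    case (insert d Y)
    then obtain a where a: "a \<in> X" "d \<le> a" "d \<in> compact_elements"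
      by (auto simp: D_def)
    then have "sup a d\<^sup>\<bottom> = 1"
      using assms by (auto simp: Vir_def pure_def)
    then have "1 \<le> sup (Sup X) d\<^sup>\<bottom>"
      by (metis Sup_upper a(1) order_refl sup_mono)
    then have d: "sup (d\<^sup>\<bottom>) (Sup X) = 1"
      by (metis antisym le_one sup.commute)
    have Y: "sup ((Sup Y)\<^sup>\<bottom>) (Sup X) = 1"
      using insert by (simp add: sup.commute)
    have "inf (d\<^sup>\<bottom>) ((Sup Y)\<^sup>\<bottom>) \<le> (Sup (insert d Y))\<^sup>\<bottom>"
    proof -
      let ?x = "inf (d\<^sup>\<bottom>) ((Sup Y)\<^sup>\<bottom>)"
      have "d * ?x = bot" "Sup Y * ?x = bot"
        by (simp_all flip: le_annihilator_iff)
      then have "?x * sup d (Sup Y) = bot"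
        by (metis mult_sup_right mult.commute sup.idem)
      then show ?thesis
        by (metis Sup_insert le_annihilator_iff mult.commute)
    qed
    then have "sup (inf (d\<^sup>\<bottom>) ((Sup Y)\<^sup>\<bottom>)) (Sup X) \<le> sup (Sup X) ((Sup (insert d Y))\<^sup>\<bottom>)"
      by (simp add: le_supI2)
    then show ?case
      using sup_inf_eq_one[OF d Y] by (simp add: antisym le_one)
  qed
  moreover have "(Sup Y)\<^sup>\<bottom> \<le> c\<^sup>\<bottom>"
  proof -
    have "(Sup Y)\<^sup>\<bottom> * c \<le> (Sup Y)\<^sup>\<bottom> * Sup Y"
      using Y(3) by (rule mult_mono_right)
    then show ?thesis
      by (metis le_annihilator_iff mult.commute mult_annihilator bot.extremum_unique)
  qed
  ultimately show "sup (Sup X) c\<^sup>\<bottom> = 1"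
    by (metis antisym le_one order_refl sup_mono)
qed

end

theory Submission
  imports Defs
begin

text \<open>
  The key point is that a pure element \<open>x\<close> can be separated from each compact \<open>c \<le> x\<close> inside
  \<open>Vir\<close>. Purity gives \<open>x \<squnion> c\<^sup>\<bottom> = 1\<close>, hence a compact \<open>d \<le> c\<^sup>\<bottom>\<close> with
  \<open>x \<squnion> d = 1\<close>. As \<open>c\<^sup>\<bottom>\<close> is pure, \<open>c\<^sup>\<bottom> \<squnion> d\<^sup>\<bottom> = 1\<close>, hence compact
  \<open>f \<le> c\<^sup>\<bottom>\<close> and \<open>e \<le> d\<^sup>\<bottom>\<close> with \<open>f \<squnion> e = 1\<close>. Then \<open>u = f\<^sup>\<bottom>\<close> and \<open>v = e\<^sup>\<bottom>\<close> are
  pure with \<open>c \<le> u\<close>, \<open>x \<squnion> v = 1\<close> and \<open>u \<sqinter> v = 0\<close>. A prime \<open>p \<le> x\<close> lies above \<open>u\<close> or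
  above \<open>v\<close>, so that \<open>c \<le> p\<close> or \<open>x = 1\<close>.
\<close>

lemma sup_compact:
  fixes c d :: "'a::complete_lattice"
  assumes "c \<in> compact_elements" "d \<in> compact_elements"
  shows "sup c d \<in> compact_elements"
  unfolding compact_elements_def
proof (intro CollectI allI impI)
  fix X assume X: "sup c d \<le> Sup X"
  obtain Y where Y: "Y \<subseteq> X" "finite Y" "c \<le> Sup Y"
    using assms(1) X unfolding compact_elements_def by auto
  obtain Z where Z: "Z \<subseteq> X" "finite Z" "d \<le> Sup Z"
    using assms(2) X unfolding compact_elements_def by auto
  have "sup c d \<le> Sup (Y \<union> Z)"
    using Y(3) Z(3) by (simp add: Sup_union_distrib le_supI1 le_supI2)
  then show "\<exists>Y\<subseteq>X. finite Y \<and> sup c d \<le> Sup Y"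
    using Y(1,2) Z(1,2) by (intro exI[of _ "Y \<union> Z"]) auto
qed

lemma finite_Sup_compact:
  fixes Y :: "'a::complete_lattice set"
  assumes "finite Y" "Y \<subseteq> compact_elements"
  shows "Sup Y \<in> compact_elements"
  using assms
proof (induction Y rule: finite_induct)
  case empty
  then show ?case
    by (auto simp: compact_elements_def)
next
  case (insert c Y)
  then show ?case
    by (simp add: sup_compact)
qed

text \<open>Since \<open>a\<close> is a join of compact elements, compactness of \<open>1\<close>
  leaves finitely many of them that still join with \<open>b\<close> to \<open>1\<close>.\<close>

lemma sup_eq_one_compact_left:
  fixes a b :: "'a::coherent_quantale"
  assumes "sup a b = 1"
  obtains d where "d \<in> compact_elements" "d \<le> a" "sup d b = 1"
proof -
  obtain X where X: "X \<subseteq> compact_elements" "a = Sup X"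
    using algebraic by blast
  have "1 \<le> Sup (insert b X)"
    using assms X(2) by (simp add: sup.commute)
  then obtain Y where Y: "Y \<subseteq> insert b X" "finite Y" "1 \<le> Sup Y"
    using one_compact unfolding compact_elements_def by blast
  have Z: "Y - {b} \<subseteq> X"
    using Y(1) by auto
  \<comment> \<open>The subcover \<open>Y\<close> may or may not contain \<open>b\<close>; putting
    \<open>b\<close> back treats both cases at once.\<close>
  have "1 \<le> Sup (insert b (Y - {b}))"
    using Y(3) Sup_subset_mono[of Y "insert b (Y - {b})"] by (auto intro: order_trans)
  then have "sup (Sup (Y - {b})) b = 1"
    by (metis Sup_insert sup.commute le_one antisym)
  moreover have "Sup (Y - {b}) \<in> compact_elements"
    using Y(2) X(1) Z by (intro finite_Sup_compact) auto
  moreover have "Sup (Y - {b}) \<le> a"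
    using Z X(2) by (simp add: Sup_subset_mono)
  ultimately show thesis
    using that by blast
qed

lemma sup_eq_one_compact:
  fixes a b :: "'a::coherent_quantale"
  assumes "sup a b = 1"
  obtains d e where "d \<in> compact_elements" "d \<le> a" "e \<in> compact_elements" "e \<le> b"
    "sup d e = 1"
proof -
  obtain d where d: "d \<in> compact_elements" "d \<le> a" "sup d b = 1"
    using sup_eq_one_compact_left[OF assms] .
  have "sup b d = 1"
    using d(3) by (simp add: sup.commute)
  then obtain e where "e \<in> compact_elements" "e \<le> b" "sup e d = 1"
    using sup_eq_one_compact_left by blast
  with d(1,2) that show thesis
    by (simp add: sup.commute)
qed

lemma le_annihilator_commute:
  "a \<le> b\<^sup>\<bottom> \<longleftrightarrow> b \<le> a\<^sup>\<bottom>" for a b :: "'a::comm_integral_quantale"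
  by (simp add: le_annihilator_iff mult.commute)

text \<open>The meet multiplies both \<open>a\<close> and \<open>b\<close> to \<open>bot\<close>,
  hence also their join, which is the unit.\<close>

lemma inf_annihilator_eq_bot:
  fixes a b :: "'a::comm_integral_quantale"
  assumes "sup a b = 1"
  shows "inf (a\<^sup>\<bottom>) (b\<^sup>\<bottom>) = bot"
proof -
  let ?y = "inf (a\<^sup>\<bottom>) (b\<^sup>\<bottom>)"
  have "?y * a = bot" "?y * b = bot"
    by (simp_all add: mult.commute[of ?y] flip: le_annihilator_iff)
  then have "?y * sup a b = bot"
    by (simp add: mult_sup_right)
  then show ?thesis
    using assms by simp
qed

lemma sup_eq_one_mono:
  fixes a b c :: "'a::comm_integral_quantale"
  assumes "sup a b = 1" "b \<le> c"
  shows "sup a c = 1"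
  using assms by (metis antisym le_one order_refl sup_mono)

lemma Vir_separation:
  fixes x c :: "'a::{coherent_quantale, pf_quantale}"
  assumes x: "x \<in> Vir" and c: "c \<in> compact_elements" "c \<le> x"
  obtains u v where "u \<in> Vir" "v \<in> Vir" "c \<le> u" "sup x v = 1" "inf u v = bot"
proof -
  have "sup (c\<^sup>\<bottom>) x = 1"
    using x c by (simp add: Vir_def pure_def sup.commute)
  then obtain d where d: "d \<in> compact_elements" "d \<le> c\<^sup>\<bottom>" "sup d x = 1"
    using sup_eq_one_compact_left by blast
  have "sup (c\<^sup>\<bottom>) (d\<^sup>\<bottom>) = 1"
    using pure_annihilator[OF c(1)] d(1,2) by (simp add: pure_def)
  then obtain f e where f: "f \<in> compact_elements" "f \<le> c\<^sup>\<bottom>"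
    and e: "e \<in> compact_elements" "e \<le> d\<^sup>\<bottom>" and fe: "sup f e = 1"
    by (rule sup_eq_one_compact)
  show thesis
  proof (rule that)
    show "f\<^sup>\<bottom> \<in> Vir" "e\<^sup>\<bottom> \<in> Vir"
      using f(1) e(1) by (simp_all add: Vir_def pure_annihilator)
    show "c \<le> f\<^sup>\<bottom>"
      using f(2) le_annihilator_commute by blast
    have "d \<le> e\<^sup>\<bottom>"
      using e(2) le_annihilator_commute by blast
    then show "sup x (e\<^sup>\<bottom>) = 1"
      using d(3) sup_eq_one_mono by (metis sup.commute)
    show "inf (f\<^sup>\<bottom>) (e\<^sup>\<bottom>) = bot"
      using fe by (rule inf_annihilator_eq_bot)
  qed
qed

lemma Spec_Vir_maximal:
  fixes p x :: "'a::{coherent_quantale, pf_quantale}"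
  assumes p: "p \<in> Spec Vir" and x: "x \<in> Vir" "x \<noteq> 1" "p \<le> x"
  shows "x = p"
proof (rule antisym)
  obtain X where X: "X \<subseteq> compact_elements" "x = Sup X"
    using algebraic by blast
  have "c \<le> p" if "c \<in> X" for c
  proof -
    have c: "c \<in> compact_elements" "c \<le> x"
      using that X by (auto intro: Sup_upper)
    obtain u v where uv: "u \<in> Vir" "v \<in> Vir" "c \<le> u" "sup x v = 1" "inf u v = bot"
      using Vir_separation[OF x(1) c] .
    have "u \<le> p \<or> v \<le> p"
      using p uv(1,2,5) by (simp add: Spec_def)
    \<comment> \<open>Otherwise \<open>v \<le> p \<le> x\<close> would give
      \<open>x = sup x v = 1\<close>.\<close>
    moreover have "\<not> v \<le> p"
      using uv(4) x(2,3) by (metis order_trans sup.absorb1)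
    ultimately show ?thesis
      using uv(3) by auto
  qed
  then show "x \<le> p"
    using X(2) by (simp add: Sup_least)
qed (rule x(3))

lemma sup_in_Vir:
  fixes a b :: "'a::algebraic_quantale"
  assumes "a \<in> Vir" "b \<in> Vir"
  shows "sup a b \<in> Vir"
  using Sup_in_Vir[of "{a, b}"] assms by simp

text \<open>As for maximal ideals: if neither \<open>a\<close> nor \<open>b\<close> lies below
  \<open>m\<close>, each joins with \<open>m\<close> to \<open>1\<close>, so \<open>inf a b\<close>
  does too and cannot lie below \<open>m\<close>.\<close>

lemma Max_Vir_prime:
  fixes m :: "'a::algebraic_quantale"
  assumes m: "m \<in> Max_elements Vir"
  shows "m \<in> Spec Vir"
proof -
  have mV: "m \<in> Vir" "m \<noteq> 1"
    using m by (simp_all add: Max_elements_def)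
  have top: "sup a m = 1" if "a \<in> Vir" "\<not> a \<le> m" for a
  proof (rule ccontr)
    assume "sup a m \<noteq> 1"
    \<comment> \<open>The join is pure, lies above \<open>m\<close> and differs from
      \<open>1\<close>, so maximality applies.\<close>
    then have "sup a m = m"
      using m sup_in_Vir[OF that(1) mV(1)] by (simp add: Max_elements_def)
    with that(2) show False
      by (metis sup.cobounded1)
  qed
  have "a \<le> m \<or> b \<le> m" if "a \<in> Vir" "b \<in> Vir" "inf a b \<le> m" for a b
    using sup_inf_eq_one[of a m b] top that mV(2) by (auto simp: sup.absorb2)
  then show ?thesis
    using mV le_one[of m] by (auto simp: Spec_def less_le)
qed

theorem theorem6p15:
  "Spec (Vir :: 'a::{coherent_quantale, pf_quantale} set) = Max_elements (Vir :: 'a set)"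
proof (intro equalityI subsetI)
  fix p :: 'a assume p: "p \<in> Spec Vir"
  then have "p \<in> Vir - {1}"
    by (auto simp: Spec_def)
  then show "p \<in> Max_elements Vir"
    using Spec_Vir_maximal[OF p] by (auto simp: Max_elements_def)
qed (rule Max_Vir_prime)

end
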